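(* Let $q$ be a prime power, $1\le k\le n$, $\epsilon\in(0,0.5]$, and $m=q^{(1-\epsilon)k}$. Suppose $q\ge (2e^3n^2)^{1/\epsilon}$. Then every $(k,m)$-Furstenberg set $S\subseteq\mathbb{F}_q^n$ satisfies $$|S|\ge \frac{1}{(2e)^{n-k+1}}\, m^{n/k}.$$
   Context: $\mathbb{F}_q$ is the finite field with $q$ elements. A $k$-dimensional linear subspace of $\mathbb{F}_q^n$ is a $k$-dimensional vector subspace. For a real number $m$, a set $S\subseteq\mathbb{F}_q^n$ is called $(k,m)$-Furstenberg if for every $k$-dimensional linear subspace $V$ there is a translate $V+a$ ($a\in\mathbb{F}_q^n$) with $|S\cap (V+a)|\ge m$. *)

theory Defs
  imports "HOL-Analysis.Analysis"
begin

definition furstenberg :: "nat \<Rightarrow> real \<Rightarrow> ('a::{field,finite} ^ 'n) set \<Rightarrow> bool" where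
  "furstenberg k m S \<longleftrightarrow>
     (\<forall>V. vec.subspace V \<and> vec.dim V = k \<longrightarrow>
        (\<exists>a. real (card (S \<inter> {v + a | v. v \<in> V})) \<ge> m))"

end

theory Submission imports Defs "HOL-Computational_Algebra.Polynomial" begin

text \<open>
  Write \<open>A = card S\<close> and \<open>\<beta> = (4 A) ^ (1 / n)\<close>. Unless \<open>\<beta> > q ^ (1 - \<epsilon>)\<close>, which already gives the bound, there is
  for every \<open>j < n\<close> a \<open>j\<close>-dimensional subspace all of whose translates contain at most
  \<open>((1 + 1 / n) \<beta>) ^ j\<close> points of \<open>S\<close>; for \<open>j = k\<close> this yields \<open>m ^ (n / k) \<le> (1 + 1 / n) ^ n * 4 A \<le> 4 e A\<close>.

  The subspace is enlarged one direction at a time. Let \<open>f\<close> count the points of \<open>S\<close> in the translates of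
  the current subspace, a function on a space of dimension \<open>N = n - j \<ge> 2\<close>. If every direction had a
  line on which \<open>f\<close> is large, take a nonzero polynomial of small degree \<open>d\<close> vanishing at \<open>x\<close> to order
  about \<open>f x + d / q\<close> (after rescaling). On each of these lines its derivatives of order up to \<open>d / q\<close> have
  too many roots, so those derivatives of its top form vanish at all points, contradicting
  the Schwartz-Zippel lemma with multiplicities. The shift \<open>d / q\<close> is negligible against the bound on
  \<open>f\<close> because \<open>\<beta> / q \<le> q ^ (-\<epsilon>)\<close>, which is where the lower bound on \<open>q\<close> enters.
\<close>

text \<open>A polynomial in the variables \<open>I\<close> is a finite set \<open>E\<close> of exponent vectors with a coefficient function
  \<open>c\<close>; \<open>hasse I E c \<alpha>\<close> is its Hasse derivative of multi-order \<open>\<alpha>\<close> (truncated subtraction is harmless, the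
  binomial coefficient being zero there), and \<open>hasse_line\<close> its restriction to the line
  \<open>s \<mapsto> a + s b\<close>.\<close>

definition hasse :: "'i set \<Rightarrow> ('i \<Rightarrow> nat) set \<Rightarrow> (('i \<Rightarrow> nat) \<Rightarrow> 'a) \<Rightarrow> ('i \<Rightarrow> nat) \<Rightarrow> ('i \<Rightarrow> 'a) \<Rightarrow> 'a::field"
  where "hasse I E c \<alpha> x =
    (\<Sum>\<beta>\<in>E. c \<beta> * (\<Prod>i\<in>I. of_nat (\<beta> i choose \<alpha> i)) * (\<Prod>i\<in>I. x i ^ (\<beta> i - \<alpha> i)))"

definition hasse_line ::
    "'i set \<Rightarrow> ('i \<Rightarrow> nat) set \<Rightarrow> (('i \<Rightarrow> nat) \<Rightarrow> 'a) \<Rightarrow> ('i \<Rightarrow> nat) \<Rightarrow> ('i \<Rightarrow> 'a) \<Rightarrow> ('i \<Rightarrow> 'a) \<Rightarrow> 'a::field poly"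
  where "hasse_line I E c \<alpha> a b =
    (\<Sum>\<beta>\<in>E. smult (c \<beta> * (\<Prod>i\<in>I. of_nat (\<beta> i choose \<alpha> i))) (\<Prod>i\<in>I. [:a i, b i:] ^ (\<beta> i - \<alpha> i)))"

section \<open>Taylor expansion of Hasse derivatives along a line\<close>

text \<open>The composition rule of Hasse derivatives in one coordinate. Truncated subtraction does
  not break it: for \<open>k + j > n\<close> both sides are zero.\<close>

lemma choose_mult_choose_add:
  "(n choose k) * ((n - k) choose j) = ((k + j) choose k) * (n choose (k + j))"
proof (cases "k + j \<le> n")
  case True
  then show ?thesis using choose_mult[of k "k + j" n] by (simp add: mult.commute)
next
  case False
  then show ?thesis by (cases "k \<le> n") (simp_all add: binomial_eq_0)
qed

text \<open>The binomial theorem in each coordinate, multiplied out. The common bound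
  \<open>D\<close> in place of \<open>e i\<close> keeps the index set independent of the exponents,
  so that \<open>hasse_line_taylor\<close> can interchange the sums over monomials and over
  \<gamma>.\<close>

lemma prod_add_smult_power:
  fixes x b :: "'i \<Rightarrow> 'a::field" and T :: "'a poly"
  assumes "finite I" and "\<And>i. i \<in> I \<Longrightarrow> e i \<le> D"
  shows "(\<Prod>i\<in>I. ([:x i:] + smult (b i) T) ^ e i) =
    (\<Sum>\<gamma>\<in>PiE I (\<lambda>_. {..D}).
       smult (\<Prod>i\<in>I. of_nat (e i choose \<gamma> i) * b i ^ \<gamma> i * x i ^ (e i - \<gamma> i)) (T ^ sum \<gamma> I))"
proof -
  have pw: "([:x i:] + smult (b i) T) ^ e i =
      (\<Sum>j\<le>D. smult (of_nat (e i choose j) * b i ^ j * x i ^ (e i - j)) (T ^ j))" if "i \<in> I" for i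
  proof -
    have "([:x i:] + smult (b i) T) ^ e i = (smult (b i) T + [:x i:]) ^ e i"
      by (simp add: add.commute)
    also have "\<dots> = (\<Sum>j\<le>e i. of_nat (e i choose j) * smult (b i) T ^ j * [:x i:] ^ (e i - j))"
      by (rule binomial_ring)
    also have "\<dots> = (\<Sum>j\<le>D. of_nat (e i choose j) * smult (b i) T ^ j * [:x i:] ^ (e i - j))"
      by (rule sum.mono_neutral_left) (use assms(2)[OF that] in \<open>auto simp: binomial_eq_0\<close>)
    also have "\<dots> = (\<Sum>j\<le>D. smult (of_nat (e i choose j) * b i ^ j * x i ^ (e i - j)) (T ^ j))"
    proof (rule sum.cong[OF refl])
      fix j
      have "[:x i:] ^ (e i - j) = [:x i ^ (e i - j):]" by (simp add: poly_const_pow)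
      then show "of_nat (e i choose j) * smult (b i) T ^ j * [:x i:] ^ (e i - j) =
          smult (of_nat (e i choose j) * b i ^ j * x i ^ (e i - j)) (T ^ j)"
        by (simp add: smult_power of_nat_poly mult_ac)
    qed
    finally show ?thesis .
  qed
  have ps: "(\<Prod>i\<in>J. smult (u i) (T ^ \<gamma> i)) = smult (prod u J) (T ^ sum \<gamma> J)"
    if "finite J" for u :: "'i \<Rightarrow> 'a" and \<gamma> J
    using that by (induction J) (simp_all add: power_add mult_ac)
  have "(\<Prod>i\<in>I. ([:x i:] + smult (b i) T) ^ e i) =
     (\<Prod>i\<in>I. \<Sum>j\<le>D. smult (of_nat (e i choose j) * b i ^ j * x i ^ (e i - j)) (T ^ j))"
    by (rule prod.cong[OF refl]) (rule pw)
  also have "\<dots> = (\<Sum>\<gamma>\<in>PiE I (\<lambda>_. {..D}).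
       \<Prod>i\<in>I. smult (of_nat (e i choose \<gamma> i) * b i ^ \<gamma> i * x i ^ (e i - \<gamma> i)) (T ^ \<gamma> i))"
    by (rule prod_sum_PiE) (use assms in auto)
  finally show ?thesis by (simp add: ps assms(1))
qed

lemma smult_sum_right: "smult u (\<Sum>i\<in>A. f i) = (\<Sum>i\<in>A. smult u (f i))"
  by (induction A rule: infinite_finite_induct) (simp_all add: smult_add_right)

text \<open>Each factor \<open>[:a i, b i:]\<close> is its value at \<open>s\<close> plus
  \<open>b i\<close> times \<open>[:-s, 1:]\<close>. Expanding, and composing the derivatives of
  orders \<alpha> and \<gamma>, leaves Hasse derivatives at the point with parameter
  \<open>s\<close>.\<close>

lemma hasse_line_taylor:
  assumes "finite I" "finite E"
    and D: "\<And>\<beta> i. \<beta> \<in> E \<Longrightarrow> i \<in> I \<Longrightarrow> \<beta> i \<le> D"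
  shows "hasse_line I E c \<alpha> a b =
    (\<Sum>\<gamma>\<in>PiE I (\<lambda>_. {..D}).
       smult ((\<Prod>i\<in>I. of_nat ((\<alpha> i + \<gamma> i) choose \<alpha> i) * b i ^ \<gamma> i) *
              hasse I E c (\<lambda>i. \<alpha> i + \<gamma> i) (\<lambda>i. a i + s * b i)) ([:-s, 1:] ^ sum \<gamma> I))"
proof -
  let ?T = "[:-s, 1:]" and ?x = "\<lambda>i. a i + s * b i"
  have lin: "[:a i, b i:] = [:?x i:] + smult (b i) ?T" for i by (simp add: mult.commute)
  have co: "(\<Prod>i\<in>I. of_nat (\<beta> i choose \<alpha> i)) *
      (\<Prod>i\<in>I. of_nat ((\<beta> i - \<alpha> i) choose \<gamma> i) * b i ^ \<gamma> i * ?x i ^ (\<beta> i - \<alpha> i - \<gamma> i)) =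
      (\<Prod>i\<in>I. of_nat ((\<alpha> i + \<gamma> i) choose \<alpha> i) * b i ^ \<gamma> i) *
      ((\<Prod>i\<in>I. of_nat (\<beta> i choose (\<alpha> i + \<gamma> i))) * (\<Prod>i\<in>I. ?x i ^ (\<beta> i - (\<alpha> i + \<gamma> i))))" for \<beta> \<gamma>
  proof -
    have "of_nat (\<beta> i choose \<alpha> i) * (of_nat ((\<beta> i - \<alpha> i) choose \<gamma> i) * b i ^ \<gamma> i * ?x i ^ (\<beta> i - \<alpha> i - \<gamma> i))
       = (of_nat ((\<alpha> i + \<gamma> i) choose \<alpha> i) * b i ^ \<gamma> i) *
      (of_nat (\<beta> i choose (\<alpha> i + \<gamma> i)) * ?x i ^ (\<beta> i - (\<alpha> i + \<gamma> i)))" for i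
    proof -
      have "(of_nat (\<beta> i choose \<alpha> i) * of_nat ((\<beta> i - \<alpha> i) choose \<gamma> i) :: 'b) =
          of_nat ((\<alpha> i + \<gamma> i) choose \<alpha> i) * of_nat (\<beta> i choose (\<alpha> i + \<gamma> i))"
        using choose_mult_choose_add[of "\<beta> i" "\<alpha> i" "\<gamma> i"] by (metis of_nat_mult)
      then show ?thesis by (simp add: mult_ac)
    qed
    then show ?thesis by (simp only: prod.distrib[symmetric])
  qed
  have "hasse_line I E c \<alpha> a b = (\<Sum>\<beta>\<in>E. smult (c \<beta> * (\<Prod>i\<in>I. of_nat (\<beta> i choose \<alpha> i)))
     (\<Sum>\<gamma>\<in>PiE I (\<lambda>_. {..D}). smult (\<Prod>i\<in>I. of_nat ((\<beta> i - \<alpha> i) choose \<gamma> i) * b i ^ \<gamma> i * ?x i ^ (\<beta> i - \<alpha> i - \<gamma> i))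
        (?T ^ sum \<gamma> I)))"
    unfolding hasse_line_def
  proof (rule sum.cong[OF refl])
    fix \<beta> assume "\<beta> \<in> E"
    then have "\<beta> i - \<alpha> i \<le> D" if "i \<in> I" for i using D[OF _ that] by (meson diff_le_self le_trans)
    then show "smult (c \<beta> * (\<Prod>i\<in>I. of_nat (\<beta> i choose \<alpha> i))) (\<Prod>i\<in>I. [:a i, b i:] ^ (\<beta> i - \<alpha> i)) =
      smult (c \<beta> * (\<Prod>i\<in>I. of_nat (\<beta> i choose \<alpha> i)))
     (\<Sum>\<gamma>\<in>PiE I (\<lambda>_. {..D}). smult (\<Prod>i\<in>I. of_nat ((\<beta> i - \<alpha> i) choose \<gamma> i) * b i ^ \<gamma> i * ?x i ^ (\<beta> i - \<alpha> i - \<gamma> i))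
        (?T ^ sum \<gamma> I))"
      using prod_add_smult_power[OF assms(1), of "\<lambda>i. \<beta> i - \<alpha> i" D ?x b ?T] by (simp only: lin)
  qed
  also have "\<dots> = (\<Sum>\<gamma>\<in>PiE I (\<lambda>_. {..D}). \<Sum>\<beta>\<in>E.
      smult (c \<beta> * ((\<Prod>i\<in>I. of_nat (\<beta> i choose \<alpha> i)) *
      (\<Prod>i\<in>I. of_nat ((\<beta> i - \<alpha> i) choose \<gamma> i) * b i ^ \<gamma> i * ?x i ^ (\<beta> i - \<alpha> i - \<gamma> i)))) (?T ^ sum \<gamma> I))"
    by (subst sum.swap) (simp only: smult_sum_right smult_smult mult.assoc)
  also have "\<dots> = (\<Sum>\<gamma>\<in>PiE I (\<lambda>_. {..D}).
       smult ((\<Prod>i\<in>I. of_nat ((\<alpha> i + \<gamma> i) choose \<alpha> i) * b i ^ \<gamma> i) *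
              hasse I E c (\<lambda>i. \<alpha> i + \<gamma> i) ?x) (?T ^ sum \<gamma> I))"
    unfolding co hasse_def sum_distrib_left smult_sum
    by (intro sum.cong refl) (simp add: mult_ac)
  finally show ?thesis .
qed

text \<open>Taylor terms with \<open>sum \<gamma> I < r - sum \<alpha> I\<close> carry a derivative
  of order below \<open>r\<close> and vanish; the others contain the power explicitly. So a
  derivative costs at most its order in multiplicity.\<close>

lemma hasse_line_dvd:
  assumes "finite I" "finite E"
    and van: "\<And>\<alpha>. sum \<alpha> I < r \<Longrightarrow> hasse I E c \<alpha> (\<lambda>i. a i + s * b i) = 0"
  shows "[:-s, 1:] ^ (r - sum \<alpha> I) dvd hasse_line I E c \<alpha> a b"
proof -
  define D where "D = (\<Sum>\<beta>\<in>E. sum \<beta> I)"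
  have D: "\<beta> i \<le> D" if "\<beta> \<in> E" "i \<in> I" for \<beta> i
    using member_le_sum[of i I \<beta>] member_le_sum[of \<beta> E "\<lambda>\<beta>. sum \<beta> I"] that assms
    unfolding D_def by force
  have "hasse_line I E c \<alpha> a b =
    (\<Sum>\<gamma>\<in>PiE I (\<lambda>_. {..D}).
       smult ((\<Prod>i\<in>I. of_nat ((\<alpha> i + \<gamma> i) choose \<alpha> i) * b i ^ \<gamma> i) *
              hasse I E c (\<lambda>i. \<alpha> i + \<gamma> i) (\<lambda>i. a i + s * b i)) ([:-s, 1:] ^ sum \<gamma> I))"
    by (rule hasse_line_taylor[OF assms(1,2)]) (rule D)
  also have "[:-s, 1:] ^ (r - sum \<alpha> I) dvd \<dots>"
  proof (rule dvd_sum)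
    fix \<gamma>
    let ?h = "hasse I E c (\<lambda>i. \<alpha> i + \<gamma> i) (\<lambda>i. a i + s * b i)"
    show "[:-s, 1:] ^ (r - sum \<alpha> I) dvd
      smult ((\<Prod>i\<in>I. of_nat ((\<alpha> i + \<gamma> i) choose \<alpha> i) * b i ^ \<gamma> i) * ?h) ([:-s, 1:] ^ sum \<gamma> I)"
    proof (cases "sum \<gamma> I < r - sum \<alpha> I")
      case True
      then have "?h = 0" by (intro van) (simp add: sum.distrib)
      then show ?thesis by simp
    next
      case False
      then show ?thesis by (intro dvd_smult le_imp_power_dvd) simp
    qed
  qed
  finally show ?thesis .
qed

section \<open>Degree and leading coefficient of the restriction to a line\<close>

lemma coeff_mult_degree_bounds:
  fixes p r :: "'a::comm_semiring_0 poly"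
  assumes "degree p \<le> m" "degree r \<le> n"
  shows "coeff (p * r) (m + n) = coeff p m * coeff r n"
proof (cases "degree p = m \<and> degree r = n")
  case True
  then show ?thesis using coeff_mult_degree_sum[of p r] by blast
next
  case False
  then have "coeff p m * coeff r n = 0" using assms by (auto simp: coeff_eq_0)
  moreover have "degree (p * r) < m + n" using degree_mult_le[of p r] assms False by linarith
  ultimately show ?thesis by (simp add: coeff_eq_0)
qed

lemma prod_linear_power_top:
  fixes a b :: "'i \<Rightarrow> 'a::field"
  assumes "finite I"
  shows "degree (\<Prod>i\<in>I. [:a i, b i:] ^ e i) \<le> sum e I"
    and "coeff (\<Prod>i\<in>I. [:a i, b i:] ^ e i) (sum e I) = (\<Prod>i\<in>I. b i ^ e i)"
proof -
  have pw: "degree ([:u, v:] ^ k) \<le> k \<and> coeff ([:u, v:] ^ k) k = v ^ k" for u v :: 'a and k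
  proof (induction k)
    case (Suc k)
    have 1: "degree [:u, v:] \<le> 1" by simp
    show ?case using coeff_mult_degree_bounds[OF 1 conjunct1[OF Suc]] Suc 1
      degree_mult_le[of "[:u, v:]" "[:u,v:]^k"] by (simp del: mult_pCons_left)
  qed auto
  have "degree (\<Prod>i\<in>I. [:a i, b i:] ^ e i) \<le> sum e I \<and>
    coeff (\<Prod>i\<in>I. [:a i, b i:] ^ e i) (sum e I) = (\<Prod>i\<in>I. b i ^ e i)"
    using assms
  proof (induction I)
    case (insert i I)
    then show ?case
      using coeff_mult_degree_bounds[of "[:a i, b i:] ^ e i" "e i" "\<Prod>i\<in>I. [:a i, b i:] ^ e i" "sum e I"]
        pw[of "a i" "b i" "e i"] degree_mult_le[of "[:a i, b i:] ^ e i" "\<Prod>i\<in>I. [:a i, b i:] ^ e i"]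
      by auto
  qed simp
  then show "degree (\<Prod>i\<in>I. [:a i, b i:] ^ e i) \<le> sum e I"
    "coeff (\<Prod>i\<in>I. [:a i, b i:] ^ e i) (sum e I) = (\<Prod>i\<in>I. b i ^ e i)" by auto
qed

lemma degree_hasse_line_le:
  assumes "finite I" and "\<And>\<beta>. \<beta> \<in> E \<Longrightarrow> sum \<beta> I \<le> d"
  shows "degree (hasse_line I E c \<alpha> a b) \<le> d"
  unfolding hasse_line_def
proof (cases "finite E")
  case True
  show "degree (\<Sum>\<beta>\<in>E. smult (c \<beta> * (\<Prod>i\<in>I. of_nat (\<beta> i choose \<alpha> i))) (\<Prod>i\<in>I. [:a i, b i:] ^ (\<beta> i - \<alpha> i))) \<le> d"
  proof (rule degree_sum_le[OF True])
    fix \<beta> assume "\<beta> \<in> E"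
    have "degree (\<Prod>i\<in>I. [:a i, b i:] ^ (\<beta> i - \<alpha> i)) \<le> (\<Sum>i\<in>I. \<beta> i - \<alpha> i)"
      by (rule prod_linear_power_top(1)[OF assms(1)])
    also have "\<dots> \<le> sum \<beta> I" by (rule sum_mono) simp
    also have "\<dots> \<le> d" using assms(2) \<open>\<beta> \<in> E\<close> by simp
    finally show "degree (smult (c \<beta> * (\<Prod>i\<in>I. of_nat (\<beta> i choose \<alpha> i))) (\<Prod>i\<in>I. [:a i, b i:] ^ (\<beta> i - \<alpha> i))) \<le> d"
      using degree_smult_le le_trans by blast
  qed
qed simp

text \<open>Only monomials of full degree \<open>d\<close> reach the exponent
  \<open>d - sum \<alpha> I\<close>, and their top coefficients involve the direction
  \<open>b\<close> but not the base point \<open>a\<close>. Hence one nonvanishing derivative of the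
  top form at \<open>b\<close> makes the restriction nonzero on all lines of that direction at
  once.\<close>

lemma coeff_hasse_line_top:
  assumes "finite I" "finite E" and "\<And>\<beta>. \<beta> \<in> E \<Longrightarrow> sum \<beta> I \<le> d"
  shows "coeff (hasse_line I E c \<alpha> a b) (d - sum \<alpha> I) = hasse I {\<beta>\<in>E. sum \<beta> I = d} c \<alpha> b"
proof -
  have "coeff (hasse_line I E c \<alpha> a b) (d - sum \<alpha> I) =
    (\<Sum>\<beta>\<in>E. (c \<beta> * (\<Prod>i\<in>I. of_nat (\<beta> i choose \<alpha> i))) *
       coeff (\<Prod>i\<in>I. [:a i, b i:] ^ (\<beta> i - \<alpha> i)) (d - sum \<alpha> I))"
    unfolding hasse_line_def by (simp add: coeff_sum)
  also have "\<dots> = (\<Sum>\<beta>\<in>E. if sum \<beta> I = d then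
      c \<beta> * (\<Prod>i\<in>I. of_nat (\<beta> i choose \<alpha> i)) * (\<Prod>i\<in>I. b i ^ (\<beta> i - \<alpha> i)) else 0)"
  proof (rule sum.cong[OF refl])
    fix \<beta> assume \<beta>: "\<beta> \<in> E"
    show "(c \<beta> * (\<Prod>i\<in>I. of_nat (\<beta> i choose \<alpha> i))) *
       coeff (\<Prod>i\<in>I. [:a i, b i:] ^ (\<beta> i - \<alpha> i)) (d - sum \<alpha> I) =
      (if sum \<beta> I = d then
      c \<beta> * (\<Prod>i\<in>I. of_nat (\<beta> i choose \<alpha> i)) * (\<Prod>i\<in>I. b i ^ (\<beta> i - \<alpha> i)) else 0)"
    \<comment> \<open>If some \<open>\<alpha> i\<close> exceeds \<open>\<beta> i\<close>, a binomial
      factor is zero; otherwise the exponents subtract without truncation and their sum drops by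
      exactly \<open>sum \<alpha> I\<close>.\<close>
    proof (cases "\<forall>i\<in>I. \<alpha> i \<le> \<beta> i")
      case False
      then have "(\<Prod>i\<in>I. of_nat (\<beta> i choose \<alpha> i)) = (0::'b)"
        using assms(1) by (intro prod_zero) (metis binomial_eq_0 not_le of_nat_0)+
      then show ?thesis by simp
    next
      case True
      then have s: "(\<Sum>i\<in>I. \<beta> i - \<alpha> i) = sum \<beta> I - sum \<alpha> I" and le: "sum \<alpha> I \<le> sum \<beta> I"
        by (auto intro: sum_subtractf_nat sum_mono)
      show ?thesis
      proof (cases "sum \<beta> I = d")
        case True
        then show ?thesis using prod_linear_power_top(2)[OF assms(1), of a b "\<lambda>i. \<beta> i - \<alpha> i"] s by simp
      next
        case False
        then have "(\<Sum>i\<in>I. \<beta> i - \<alpha> i) < d - sum \<alpha> I" using assms(3)[OF \<beta>] s le by linarith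
        then have "coeff (\<Prod>i\<in>I. [:a i, b i:] ^ (\<beta> i - \<alpha> i)) (d - sum \<alpha> I) = 0"
          using prod_linear_power_top(1)[OF assms(1), of a b "\<lambda>i. \<beta> i - \<alpha> i"] by (intro coeff_eq_0) simp
        then show ?thesis using False by simp
      qed
    qed
  qed
  also have "\<dots> = hasse I {\<beta>\<in>E. sum \<beta> I = d} c \<alpha> b"
    unfolding hasse_def by (simp add: sum.inter_filter[OF assms(2)])
  finally show ?thesis .
qed

section \<open>Root multiplicities and the Schwartz-Zippel lemma\<close>

lemma sum_root_multiplicities_le_degree:
  fixes p :: "'a::{field,finite} poly"
  assumes "p \<noteq> 0" and "\<And>s. [:-s, 1:] ^ k s dvd p"
  shows "(\<Sum>s\<in>UNIV. k s) \<le> degree p"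
proof -
  have "(\<Sum>s\<in>UNIV. k s) \<le> (\<Sum>s\<in>UNIV. order s p)"
    by (rule sum_mono) (use assms order_divides in blast)
  also have "\<dots> = (\<Sum>s\<in>{s. poly p s = 0}. order s p)"
    by (rule sum.mono_neutral_right) (auto simp: order_root)
  also have "\<dots> \<le> degree p" using sum_order_le_degree[OF assms(1)] by (simp add: conj_commute)
  finally show ?thesis .
qed

text \<open>Extending by zero makes equality of functions the same as equality on \<open>I\<close>.
  The encoding serves both for points over the field and for exponent vectors.\<close>

definition fin_points :: "'i set \<Rightarrow> ('i \<Rightarrow> 'a::zero) set"
  where "fin_points I = {x. \<forall>i. i \<notin> I \<longrightarrow> x i = 0}"

definition exponents :: "'i set \<Rightarrow> nat \<Rightarrow> ('i \<Rightarrow> nat) set"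
  where "exponents I d = {\<beta> \<in> fin_points I. sum \<beta> I \<le> d}"

text \<open>In the induction step, differentiate the leading coefficient with respect to the new variable,
  and count the multiplicities of the roots along the line in that direction.\<close>

lemma schwartz_zippel_multiplicity:
  fixes c :: "('i \<Rightarrow> nat) \<Rightarrow> 'a::{field,finite}"
  assumes "finite I" "finite E" "E \<noteq> {}" "\<And>\<beta>. \<beta> \<in> E \<Longrightarrow> c \<beta> \<noteq> 0" "E \<subseteq> exponents I d"
  shows "\<exists>x \<alpha>. x \<in> fin_points I \<and> CARD('a) * sum \<alpha> I \<le> d \<and> hasse I E c \<alpha> x \<noteq> 0"
  using assms
proof (induction I arbitrary: E c d)
  case empty
  have "E \<subseteq> {\<lambda>_. 0}" using empty(4) by (auto simp: exponents_def fin_points_def)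
  then have E: "E = {\<lambda>_. 0}" using empty(2) by blast
  show ?case
    by (rule exI[of _ "\<lambda>_. 0"], rule exI[of _ "\<lambda>_. 0"])
      (use empty(3)[of "\<lambda>_. 0"] in \<open>simp add: hasse_def E fin_points_def\<close>)
next
  case (insert i I)
  let ?q = "CARD('a)"
  define t where "t = Max ((\<lambda>\<beta>. \<beta> i) ` E)"
  have tmax: "\<beta> i \<le> t" if "\<beta> \<in> E" for \<beta>
    using that insert.prems by (auto simp: t_def)
  have "t \<in> (\<lambda>\<beta>. \<beta> i) ` E" unfolding t_def using insert.prems by (intro Max_in) auto
  then obtain \<beta>0 where \<beta>0: "\<beta>0 \<in> E" "\<beta>0 i = t" by auto
  define Et where "Et = {\<beta>\<in>E. \<beta> i = t}"
  define E' where "E' = (\<lambda>\<beta>. \<beta>(i := 0)) ` Et"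
  define c' where "c' = (\<lambda>\<beta>. c (\<beta>(i := t)))"
  have sumE: "sum \<beta> (insert i I) = \<beta> i + sum \<beta> I" for \<beta> :: "'i \<Rightarrow> nat"
    using insert.hyps by simp
  have supd: "sum (\<beta>(i := j)) I = sum \<beta> I" for \<beta> :: "'i \<Rightarrow> nat" and j
    using insert.hyps by (intro sum.cong) auto
  have upd: "(\<beta>(i := 0))(i := t) = \<beta>" if "\<beta> \<in> Et" for \<beta>
    using that by (auto simp: Et_def)
  have degE: "sum \<beta> I + \<beta> i \<le> d" if "\<beta> \<in> E" for \<beta>
    using insert.prems(4) that sumE[of \<beta>] by (auto simp: exponents_def)
  have td: "t \<le> d" using degE[OF \<beta>0(1)] \<beta>0(2) by simp
  \<comment> \<open>The induction hypothesis is applied to the coefficient of the top power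
    \<open>t\<close> of the new variable, a polynomial in \<open>I\<close> of degree at most
    \<open>d - t\<close>.\<close>
  have "\<exists>x \<alpha>. x \<in> fin_points I \<and> ?q * sum \<alpha> I \<le> d - t \<and> hasse I E' c' \<alpha> x \<noteq> 0"
  proof (rule insert.IH)
    show "finite E'" using insert.prems by (simp add: E'_def Et_def)
    show "E' \<noteq> {}" using \<beta>0 by (auto simp: E'_def Et_def)
    show "c' \<beta> \<noteq> 0" if "\<beta> \<in> E'" for \<beta>
      using that insert.prems(3) upd by (auto simp: E'_def c'_def Et_def)
    show "E' \<subseteq> exponents I (d - t)"
    proof
      fix \<beta>' assume "\<beta>' \<in> E'"
      then obtain \<beta> where \<beta>: "\<beta> \<in> E" "\<beta> i = t" "\<beta>' = \<beta>(i := 0)" by (auto simp: E'_def Et_def)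
      moreover have "sum \<beta>' I \<le> d - t" using degE[OF \<beta>(1)] \<beta> supd by simp
      ultimately show "\<beta>' \<in> exponents I (d - t)"
        using insert.prems(4) by (auto simp: exponents_def fin_points_def)
    qed
  qed
  then obtain x \<alpha> where x: "x \<in> fin_points I" and \<alpha>: "?q * sum \<alpha> I \<le> d - t"
    and nz: "hasse I E' c' \<alpha> x \<noteq> 0" by blast
  \<comment> \<open>No differentiation in the new variable, and \<open>b\<close> is its unit vector.
    So \<open>U\<close> is the \<alpha>-th derivative at \<open>x\<close> as a polynomial in that
    variable, and its coefficient at \<open>t\<close> is the nonzero value just found.\<close>
  define \<alpha>1 where "\<alpha>1 = \<alpha>(i := 0)"
  define b :: "'i \<Rightarrow> 'a" where "b = (\<lambda>k. if k = i then 1 else 0)"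
  define K where "K = (\<lambda>\<beta>. c \<beta> * (\<Prod>k\<in>I. of_nat (\<beta> k choose \<alpha> k)) * (\<Prod>k\<in>I. x k ^ (\<beta> k - \<alpha> k)))"
  define U where "U = hasse_line (insert i I) E c \<alpha>1 x b"
  have xi: "x i = 0" using x insert.hyps by (simp add: fin_points_def)
  have U: "U = (\<Sum>\<beta>\<in>E. monom (K \<beta>) (\<beta> i))"
    unfolding U_def hasse_line_def
  proof (rule sum.cong[OF refl])
    fix \<beta> assume "\<beta> \<in> E"
    have 1: "(\<Prod>k\<in>I. of_nat (\<beta> k choose \<alpha>1 k)) = (\<Prod>k\<in>I. of_nat (\<beta> k choose \<alpha> k) :: 'a)"
      using insert.hyps by (intro prod.cong) (auto simp: \<alpha>1_def)
    have 2: "(\<Prod>k\<in>I. [:x k, b k:] ^ (\<beta> k - \<alpha>1 k)) = (\<Prod>k\<in>I. [:x k ^ (\<beta> k - \<alpha> k):])"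
      using insert.hyps by (intro prod.cong) (auto simp: \<alpha>1_def b_def poly_const_pow)
    have 3: "(\<Prod>k\<in>J. [:u k:]) = [:\<Prod>k\<in>J. u k:]" if "finite J" for J and u :: "'i \<Rightarrow> 'a"
      using that by (induction J) (simp_all add: one_pCons)
    have 4: "[:x i, b i:] ^ \<beta> i = monom 1 (\<beta> i)"
      by (simp add: xi b_def monom_altdef)
    have 5: "\<alpha>1 i = 0" by (simp add: \<alpha>1_def)
    show "smult (c \<beta> * (\<Prod>k\<in>insert i I. of_nat (\<beta> k choose \<alpha>1 k)))
        (\<Prod>k\<in>insert i I. [:x k, b k:] ^ (\<beta> k - \<alpha>1 k)) = monom (K \<beta>) (\<beta> i)"
      using insert.hyps by (simp add: 1 2 3 4 5 K_def smult_monom mult_ac)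
  qed
  have "coeff U t = (\<Sum>\<beta>\<in>E. if \<beta> i = t then K \<beta> else 0)"
    unfolding U by (simp add: coeff_sum)
  also have "\<dots> = sum K Et"
    unfolding Et_def using insert.prems(1) by (simp add: sum.inter_filter)
  also have "\<dots> = hasse I E' c' \<alpha> x"
    unfolding hasse_def E'_def
  proof (subst sum.reindex)
    show "inj_on (\<lambda>\<beta>. \<beta>(i := 0)) Et" by (rule inj_onI) (metis upd)
    show "sum K Et = sum ((\<lambda>\<beta>. c' \<beta> * (\<Prod>i\<in>I. of_nat (\<beta> i choose \<alpha> i)) * (\<Prod>i\<in>I. x i ^ (\<beta> i - \<alpha> i))) \<circ> (\<lambda>\<beta>. \<beta>(i := 0))) Et"
    proof (rule sum.cong[OF refl])
      fix \<beta> assume \<beta>: "\<beta> \<in> Et"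
      have ne: "k \<noteq> i" if "k \<in> I" for k using insert.hyps that by auto
      show "K \<beta> = ((\<lambda>\<beta>. c' \<beta> * (\<Prod>i\<in>I. of_nat (\<beta> i choose \<alpha> i)) * (\<Prod>i\<in>I. x i ^ (\<beta> i - \<alpha> i))) \<circ> (\<lambda>\<beta>. \<beta>(i := 0))) \<beta>"
        using upd[OF \<beta>] by (simp add: K_def c'_def ne cong: prod.cong)
    qed
  qed
  finally have U0: "U \<noteq> 0" using nz by auto
  have "degree U \<le> t" unfolding U
  proof (rule degree_sum_le)
    show "degree (monom (K \<beta>) (\<beta> i)) \<le> t" if "\<beta> \<in> E" for \<beta>
      using tmax[OF that] degree_monom_le le_trans by blast
  qed (use insert.prems in simp)
  then have ord: "(\<Sum>s\<in>UNIV. order s U) \<le> t"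
    using sum_root_multiplicities_le_degree[OF U0, of "\<lambda>s. order s U"] order_1 by fastforce
  \<comment> \<open>Averaging: the multiplicities at the \<open>?q\<close> field elements add up to
    at most \<open>t\<close>.\<close>
  have "\<exists>s. ?q * order s U \<le> t"
  proof (rule ccontr)
    assume "\<not> ?thesis"
    then have "Suc t \<le> ?q * order s U" for s by (simp add: not_le Suc_le_eq)
    then have "(\<Sum>s\<in>(UNIV::'a set). Suc t) \<le> (\<Sum>s\<in>UNIV. ?q * order s U)" by (intro sum_mono)
    then have "?q * Suc t \<le> ?q * (\<Sum>s\<in>UNIV. order s U)" by (simp add: sum_distrib_left)
    then have "Suc t \<le> (\<Sum>s\<in>UNIV. order s U)"
      unfolding mult_le_cancel1 by (simp add: zero_less_card_finite)
    then show False using ord by simp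
  qed
  then obtain s where s: "?q * order s U \<le> t" by blast
  have s\<alpha>: "sum \<alpha>1 (insert i I) = sum \<alpha> I" using sumE[of \<alpha>1] supd by (simp add: \<alpha>1_def)
  \<comment> \<open>If all derivatives of order below \<open>r\<close> vanished at this point,
    \<open>s\<close> would be a root of \<open>U\<close> of multiplicity one more than its order.
    The orders add up as \<open>(d - t) + t\<close>.\<close>
  define r where "r = sum \<alpha> I + order s U + 1"
  have "\<exists>\<alpha>'. sum \<alpha>' (insert i I) < r \<and> hasse (insert i I) E c \<alpha>' (\<lambda>k. x k + s * b k) \<noteq> 0"
  proof (rule ccontr)
    assume "\<not> ?thesis"
    then have "[:-s, 1:] ^ (r - sum \<alpha>1 (insert i I)) dvd U"
      unfolding U_def using insert.hyps insert.prems by (intro hasse_line_dvd) auto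
    then have "[:-s, 1:] ^ Suc (order s U) dvd U" by (simp add: s\<alpha> r_def)
    then show False using order_2[OF U0] by simp
  qed
  then obtain \<alpha>' where \<alpha>': "sum \<alpha>' (insert i I) < r" "hasse (insert i I) E c \<alpha>' (\<lambda>k. x k + s * b k) \<noteq> 0"
    by blast
  have "?q * sum \<alpha>' (insert i I) \<le> ?q * (sum \<alpha> I + order s U)"
    using \<alpha>'(1) by (intro mult_left_mono) (auto simp: r_def)
  also have "\<dots> \<le> d" using \<alpha> s td by (simp add: distrib_left)
  finally have "?q * sum \<alpha>' (insert i I) \<le> d" .
  moreover have "(\<lambda>k. x k + s * b k) \<in> fin_points (insert i I)"
    using x by (auto simp: fin_points_def b_def)
  ultimately show ?case using \<alpha>'(2) by blast
qed

section \<open>Counting monomials and prescribing zeros with multiplicity\<close>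

text \<open>Splitting off the exponent \<open>j\<close> of the new variable gives a hockey-stick
  sum.\<close>

lemma card_exponents:
  assumes "finite I"
  shows "finite (exponents I d) \<and> card (exponents I d) = (d + card I) choose card I"
  using assms
proof (induction I arbitrary: d)
  case empty
  have "exponents {} d = {\<lambda>_ :: 'a. 0 :: nat}" by (auto simp: exponents_def fin_points_def)
  then show ?case by simp
next
  case (insert i I)
  have supd: "sum (\<beta>(i := j)) I = sum \<beta> I" for \<beta> :: "'a \<Rightarrow> nat" and j
    using insert.hyps by (intro sum.cong) auto
  have bij: "bij_betw (\<lambda>(j, \<beta>). \<beta>(i := j)) (SIGMA j:{..d}. exponents I (d - j)) (exponents (insert i I) d)"
    by (rule bij_betw_byWitness[where f' = "\<lambda>\<beta>. (\<beta> i, \<beta>(i := 0))"])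
      (use insert.hyps supd in \<open>auto simp: exponents_def fin_points_def fun_eq_iff\<close>)
  have fin: "finite (SIGMA j:{..d}. exponents I (d - j))" using insert.IH by auto
  have "card (exponents (insert i I) d) = card (SIGMA j:{..d}. exponents I (d - j))"
    using bij bij_betw_same_card by fastforce
  also have "\<dots> = (\<Sum>j\<le>d. (d - j + card I) choose card I)" using insert.IH by (subst card_SigmaI) auto
  also have "\<dots> = (\<Sum>j\<le>d. (card I + j) choose card I)"
    by (rule sum.reindex_bij_witness[of _ "\<lambda>j. d - j" "\<lambda>j. d - j"]) (auto simp: add.commute)
  also have "\<dots> = (d + card (insert i I)) choose card (insert i I)"
    using insert.hyps by (subst choose_rising_sum(1)) (simp add: add_ac)
  finally show ?case using bij_betw_finite[OF bij] fin by simp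
qed

lemma hasse_diff:
  "hasse I E (\<lambda>\<beta>. c \<beta> - c' \<beta>) \<alpha> x = hasse I E c \<alpha> x - hasse I E c' \<alpha> x"
  by (simp add: hasse_def sum_subtractf left_diff_distrib)

lemma hasse_cong_order:
  assumes "\<And>i. i \<in> I \<Longrightarrow> \<alpha> i = \<alpha>' i"
  shows "hasse I E c \<alpha> x = hasse I E c \<alpha>' x"
  by (simp add: hasse_def assms cong: prod.cong)

text \<open>By pigeonhole: there are more coefficient vectors than value patterns of the prescribed
  derivatives, so two vectors agree on all conditions, and their difference is the polynomial
  sought.\<close>

lemma exists_vanishing_polynomial:
  fixes g :: "('i \<Rightarrow> 'a::{field,finite}) \<Rightarrow> nat"
  assumes I: "finite I" and E: "finite E"
    and X: "finite X"
    and card: "(\<Sum>x\<in>X. card {\<alpha> \<in> fin_points I. sum \<alpha> I < g x}) < card E"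
  shows "\<exists>c. (\<exists>\<beta>\<in>E. c \<beta> \<noteq> 0) \<and> (\<forall>x\<in>X. \<forall>\<alpha>. sum \<alpha> I < g x \<longrightarrow> hasse I E c \<alpha> x = 0)"
proof -
  define Z where "Z = (SIGMA x:X. {\<alpha> \<in> fin_points I. sum \<alpha> I < g x})"
  have fin: "finite {\<alpha> \<in> fin_points I. sum \<alpha> I < r}" for r :: nat
    by (rule finite_subset[of _ "exponents I r"]) (use card_exponents[OF I] in \<open>auto simp: exponents_def\<close>)
  have Z: "finite Z" "card Z < card E" using X fin card by (auto simp: Z_def)
  define \<Phi> where "\<Phi> = (\<lambda>c. \<lambda>z\<in>Z. hasse I E c (snd z) (fst z))"
  have "\<not> inj_on \<Phi> (E \<rightarrow>\<^sub>E UNIV)"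
  proof
    assume "inj_on \<Phi> (E \<rightarrow>\<^sub>E UNIV)"
    then have "card (E \<rightarrow>\<^sub>E (UNIV::'a set)) \<le> card (Z \<rightarrow>\<^sub>E (UNIV::'a set))"
      by (rule card_inj_on_le) (auto simp: \<Phi>_def Z intro: finite_PiE)
    then have "CARD('a) ^ card E \<le> CARD('a) ^ card Z" by (simp add: card_funcsetE E Z)
    moreover have "1 < CARD('a)"
      using card_mono[of UNIV "{0, 1 :: 'a}"] by simp
    ultimately show False using Z(2) by (simp add: power_increasing_iff)
  qed
  then obtain c1 c2 where c: "c1 \<in> E \<rightarrow>\<^sub>E UNIV" "c2 \<in> E \<rightarrow>\<^sub>E UNIV" "c1 \<noteq> c2" "\<Phi> c1 = \<Phi> c2"
    by (auto simp: inj_on_def)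
  have "\<exists>\<beta>\<in>E. c1 \<beta> - c2 \<beta> \<noteq> 0" using c(1-3) by (metis PiE_ext eq_iff_diff_eq_0)
  moreover have "hasse I E (\<lambda>\<beta>. c1 \<beta> - c2 \<beta>) \<alpha> x = 0" if "x \<in> X" "sum \<alpha> I < g x" for x \<alpha>
  proof -
    \<comment> \<open>\<open>Z\<close> lists only orders supported on \<open>I\<close>. Cutting
      \<alpha> down to \<open>I\<close> changes neither its order nor the derivative.\<close>
    define \<alpha>' where "\<alpha>' = (\<lambda>i. if i \<in> I then \<alpha> i else 0)"
    have "sum \<alpha>' I = sum \<alpha> I" by (simp add: \<alpha>'_def)
    then have "(x, \<alpha>') \<in> Z" using that by (auto simp: Z_def fin_points_def \<alpha>'_def)
    then have "hasse I E c1 \<alpha>' x = hasse I E c2 \<alpha>' x"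
      using fun_cong[OF c(4), of "(x, \<alpha>')"] by (simp add: \<Phi>_def)
    moreover have "hasse I E (\<lambda>\<beta>. c1 \<beta> - c2 \<beta>) \<alpha> x = hasse I E (\<lambda>\<beta>. c1 \<beta> - c2 \<beta>) \<alpha>' x"
      by (rule hasse_cong_order) (simp add: \<alpha>'_def)
    ultimately show ?thesis by (simp add: hasse_diff)
  qed
  ultimately show ?thesis by (intro exI[of _ "\<lambda>\<beta>. c1 \<beta> - c2 \<beta>"]) blast
qed

lemma finite_fin_points: "finite I \<Longrightarrow> finite (fin_points I :: ('i \<Rightarrow> 'a::{zero,finite}) set)"
  using finite_set_of_finite_funs[of I "UNIV :: 'a set" 0] by (simp add: fin_points_def)

lemma card_fin_points_sum_less:
  assumes "finite I" "I \<noteq> {}"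
  shows "card {\<alpha> \<in> fin_points I. sum \<alpha> I < r} = (r + card I - 1) choose card I"
proof (cases r)
  case 0
  \<comment> \<open>For \<open>r = 0\<close> the binomial is \<open>card I - 1\<close> over
    \<open>card I\<close>, which is zero because \<open>I\<close> is nonempty.\<close>
  then show ?thesis using assms by (simp add: card_gt_0_iff)
next
  case (Suc r')
  then have "{\<alpha> \<in> fin_points I. sum \<alpha> I < r} = exponents I r'" by (auto simp: exponents_def)
  then show ?thesis using card_exponents[OF assms(1), of r'] Suc by simp
qed

section \<open>Directions in which all lines are sparse\<close>

text \<open>A polynomial of degree at most \<open>d\<close> vanishes to order \<open>g x\<close> at
  each \<open>x\<close>. Schwartz-Zippel for its top form yields a direction \<open>b\<close> and an
  order \<alpha> with \<open>sum \<alpha> I < w\<close>. On each line of direction \<open>b\<close>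
  the \<alpha>-th derivative is nonzero, so its roots, of multiplicity at least
  \<open>g - w\<close>, number at most \<open>d\<close>.\<close>

lemma exists_direction_small_multiplicity:
  fixes g :: "('i \<Rightarrow> 'a::{field,finite}) \<Rightarrow> nat"
  assumes I: "finite I" "I \<noteq> {}" and dw: "d < CARD('a) * w"
    and card: "(\<Sum>x\<in>fin_points I. (g x + card I - 1) choose card I) < (d + card I) choose card I"
  shows "\<exists>b\<in>fin_points I. b \<noteq> (\<lambda>_. 0) \<and>
    (\<forall>a\<in>fin_points I. (\<Sum>s\<in>UNIV. g (\<lambda>i. a i + s * b i) - w) \<le> d)"
proof -
  have "\<exists>c. (\<exists>\<beta>\<in>exponents I d. c \<beta> \<noteq> 0) \<and>
     (\<forall>x\<in>fin_points I. \<forall>\<alpha>. sum \<alpha> I < g x \<longrightarrow> hasse I (exponents I d) c \<alpha> x = 0)"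
    using I card by (intro exists_vanishing_polynomial)
      (auto simp: card_exponents card_fin_points_sum_less finite_fin_points)
  then obtain c where c: "\<exists>\<beta>\<in>exponents I d. c \<beta> \<noteq> 0"
    and van: "\<And>x \<alpha>. x \<in> fin_points I \<Longrightarrow> sum \<alpha> I < g x \<Longrightarrow> hasse I (exponents I d) c \<alpha> x = 0" by blast
  define E where "E = {\<beta>\<in>exponents I d. c \<beta> \<noteq> 0}"
  have fE: "finite E" "E \<noteq> {}" using c card_exponents[OF I(1), of d] by (auto simp: E_def)
  have vanE: "hasse I E c \<alpha> x = 0" if "x \<in> fin_points I" "sum \<alpha> I < g x" for x \<alpha>
  proof -
    have "hasse I E c \<alpha> x = hasse I (exponents I d) c \<alpha> x"
      unfolding hasse_def E_def using card_exponents[OF I(1), of d]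
      by (intro sum.mono_neutral_left) auto
    then show ?thesis using van[OF that] by simp
  qed
  \<comment> \<open>The true degree, possibly below \<open>d\<close>, so that the top form
    \<open>Et\<close> is nonempty.\<close>
  define d' where "d' = Max ((\<lambda>\<beta>. sum \<beta> I) ` E)"
  have d'max: "sum \<beta> I \<le> d'" if "\<beta> \<in> E" for \<beta> using that fE by (auto simp: d'_def)
  have "d' \<in> (\<lambda>\<beta>. sum \<beta> I) ` E" unfolding d'_def using fE by (intro Max_in) auto
  then obtain \<beta>0 where \<beta>0: "\<beta>0 \<in> E" "sum \<beta>0 I = d'" by auto
  have d'd: "d' \<le> d" using \<beta>0 by (auto simp: E_def exponents_def)
  define Et where "Et = {\<beta>\<in>E. sum \<beta> I = d'}"
  have "finite Et" using fE by (simp add: Et_def)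
  have q2: "1 < CARD('a)" using card_mono[of UNIV "{0, 1 :: 'a}"] by simp
  have "\<exists>b \<alpha>. b \<in> fin_points I \<and> CARD('a) * sum \<alpha> I \<le> d' \<and> hasse I Et c \<alpha> b \<noteq> 0"
    using \<open>finite Et\<close> by (rule schwartz_zippel_multiplicity[OF I(1)])
      (use I fE \<beta>0 in \<open>auto simp: Et_def E_def exponents_def\<close>)
  then obtain b0 \<alpha> where b0: "b0 \<in> fin_points I" "CARD('a) * sum \<alpha> I \<le> d'" "hasse I Et c \<alpha> b0 \<noteq> 0" by blast
  obtain b where b: "b \<in> fin_points I" "b \<noteq> (\<lambda>_. 0)" "hasse I Et c \<alpha> b \<noteq> 0"
  proof (cases "b0 = (\<lambda>_. 0)")
    case False
    then show ?thesis using b0 that by blast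
  next
    case True
    \<comment> \<open>a form of degree \<open>d'\<close> has a nonzero derivative of order \<open>\<le> d' / q\<close> at the origin only if it is constant\<close>
    obtain \<beta> where \<beta>: "\<beta> \<in> Et" "(\<Prod>i\<in>I. of_nat (\<beta> i choose \<alpha> i)) * (\<Prod>i\<in>I. b0 i ^ (\<beta> i - \<alpha> i)) \<noteq> 0"
      using b0(3) unfolding hasse_def by (metis (mono_tags, lifting) mult.assoc mult_zero_right sum.neutral)
    have "\<beta> i \<le> \<alpha> i" if "i \<in> I" for i
    proof -
      have "b0 i ^ (\<beta> i - \<alpha> i) \<noteq> 0" using \<beta>(2) I(1) that by auto
      then show ?thesis using True by (simp add: power_0_left split: if_splits)
    qed
    then have "d' \<le> sum \<alpha> I" using \<beta>(1) by (auto simp: Et_def intro: sum_mono)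
    then have "CARD('a) * d' \<le> CARD('a) * sum \<alpha> I" by simp
    then have "CARD('a) * d' \<le> d'" using b0(2) by linarith
    then have d'0: "d' = 0" using q2 mult_le_cancel2[of "CARD('a)" d' 1] by simp
    have "hasse I Et c \<alpha> x = hasse I Et c \<alpha> b0" for x
      unfolding hasse_def
    proof (intro sum.cong refl arg_cong2[where f = "(*)"] prod.cong)
      fix \<beta> i assume "\<beta> \<in> Et" "i \<in> I"
      then have "\<beta> i = 0" using d'0 I(1) by (auto simp: Et_def)
      then show "x i ^ (\<beta> i - \<alpha> i) = b0 i ^ (\<beta> i - \<alpha> i)" by simp
    qed
    then have nz: "hasse I Et c \<alpha> x \<noteq> 0" for x using b0(3) by metis
    obtain j where "j \<in> I" using I(2) by blast
    then have "(\<lambda>i. if i = j then 1 else 0 :: 'a) \<in> fin_points I" by (auto simp: fin_points_def)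
    moreover have "(\<lambda>i. if i = j then 1 else 0 :: 'a) \<noteq> (\<lambda>_. 0)" by (metis one_neq_zero)
    ultimately show ?thesis using that nz by blast
  qed
  have "CARD('a) * sum \<alpha> I < CARD('a) * w" using b0(2) d'd dw by linarith
  then have \<alpha>w: "sum \<alpha> I < w" by simp
  have "(\<Sum>s\<in>UNIV. g (\<lambda>i. a i + s * b i) - w) \<le> d" if a: "a \<in> fin_points I" for a
  proof -
    let ?R = "hasse_line I E c \<alpha> a b"
    have "coeff ?R (d' - sum \<alpha> I) = hasse I Et c \<alpha> b"
      unfolding Et_def by (rule coeff_hasse_line_top[OF I(1) fE(1) d'max])
    then have R0: "?R \<noteq> 0" using b(3) by auto
    have "[:-s, 1:] ^ (g (\<lambda>i. a i + s * b i) - sum \<alpha> I) dvd ?R" for s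
      by (rule hasse_line_dvd[OF I(1) fE(1)], rule vanE) (use a b(1) in \<open>auto simp: fin_points_def\<close>)
    then have "(\<Sum>s\<in>UNIV. g (\<lambda>i. a i + s * b i) - sum \<alpha> I) \<le> degree ?R"
      by (intro sum_root_multiplicities_le_degree[OF R0])
    also have "\<dots> \<le> d'" by (rule degree_hasse_line_le[OF I(1) d'max])
    also have "\<dots> \<le> d" by (rule d'd)
    finally have "(\<Sum>s\<in>UNIV. g (\<lambda>i. a i + s * b i) - sum \<alpha> I) \<le> d" .
    moreover have "(\<Sum>s\<in>UNIV. g (\<lambda>i. a i + s * b i) - w) \<le> (\<Sum>s\<in>UNIV. g (\<lambda>i. a i + s * b i) - sum \<alpha> I)"
      using \<alpha>w by (intro sum_mono) simp
    ultimately show ?thesis by linarith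
  qed
  then show ?thesis using b by blast
qed

lemma fact_mult_choose_ge_power: "(d + 1) ^ N \<le> fact N * ((d + N) choose N)"
proof (induction N)
  case (Suc N)
  have "(d + 1) ^ Suc N \<le> (d + Suc N) * (fact N * ((d + N) choose N))"
    using Suc mult_mono[of "d + 1" "d + Suc N" "(d + 1) ^ N"] by simp
  also have "\<dots> = fact N * (Suc N * ((d + Suc N) choose Suc N))"
    using Suc_times_binomial_eq[of "d + N" N] by (simp add: mult_ac del: binomial_Suc_Suc)
  also have "\<dots> = fact (Suc N) * ((d + Suc N) choose Suc N)" by (simp add: algebra_simps del: binomial_Suc_Suc)
  finally show ?case .
qed simp

text \<open>This is \<open>exists_direction_small_multiplicity\<close> for \<open>f\<close> rescaled
  by a large integer \<open>M\<close>. The set \<open>T\<close> lets the caller leave out points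
  with tiny \<open>f\<close>, where the shift \<open>d0 / CARD('a)\<close> would dominate.\<close>

lemma exists_direction_small_sum:
  fixes f :: "('i \<Rightarrow> 'a::{field,finite}) \<Rightarrow> nat" and d0 :: real
  assumes I: "finite I" "I \<noteq> {}" and d0: "d0 > 0" and T: "T \<subseteq> fin_points I"
    and less: "(\<Sum>x\<in>T. (real (f x) + d0 / CARD('a)) ^ card I) < d0 ^ card I"
  shows "\<exists>b\<in>fin_points I. b \<noteq> (\<lambda>_. 0) \<and>
    (\<forall>a\<in>fin_points I. (\<Sum>s\<in>UNIV. if (\<lambda>i. a i + s * b i) \<in> T then real (f (\<lambda>i. a i + s * b i)) else 0) \<le> d0)"
proof -
  define N where "N = card I"
  define t where "t = d0 / CARD('a)"
  have N: "N > 0" using I by (simp add: N_def card_gt_0_iff)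
  have fT: "finite T" using T finite_fin_points[OF I(1)] finite_subset by blast
  have t: "t > 0" "CARD('a) * t = d0" using d0 by (auto simp: t_def)
  \<comment> \<open>The term \<open>real N / real M\<close> absorbs the rounding of \<open>w\<close>
    and the \<open>N - 1\<close> in the binomial coefficient; the strict hypothesis survives it for
    large \<open>M\<close>.\<close>
  have "(\<lambda>M. \<Sum>x\<in>T. (real (f x) + t + real N / real M) ^ N) \<longlonglongrightarrow> (\<Sum>x\<in>T. (real (f x) + t + 0) ^ N)"
    by (intro tendsto_intros lim_const_over_n)
  then have "eventually (\<lambda>M. (\<Sum>x\<in>T. (real (f x) + t + real N / real M) ^ N) < d0 ^ N) sequentially"
    using less by (intro order_tendstoD) (auto simp: t_def N_def)
  then have "eventually (\<lambda>M. M > 0 \<and> (\<Sum>x\<in>T. (real (f x) + t + real N / real M) ^ N) < d0 ^ N) sequentially"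
    using eventually_gt_at_top[of "0::nat"] by (rule eventually_conj[rotated])
  then obtain M :: nat where M: "M > 0" "(\<Sum>x\<in>T. (real (f x) + t + real N / real M) ^ N) < d0 ^ N"
    by (metis (no_types, lifting) eventually_sequentially order_refl)
  \<comment> \<open>With \<open>M \<rightarrow> \<infinity>\<close> both binomial coefficients become \<open>N\<close>-th powers over \<open>N!\<close>; the shift by \<open>w\<close>
    is exactly what differentiating the top form costs.\<close>
  define w where "w = nat \<lfloor>M * t\<rfloor> + 1"
  define d where "d = nat \<lfloor>M * d0\<rfloor>"
  \<comment> \<open>Off \<open>T\<close> no vanishing is demanded; on \<open>T\<close>, subtracting
    \<open>w\<close> leaves exactly \<open>M * f x\<close>.\<close>
  define g where "g = (\<lambda>x. if x \<in> T then M * f x + w else 0)"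
  have w: "M * t < w" "w \<le> M * t + 1" using t(1) by (simp_all add: w_def) linarith+
  have d: "d \<le> M * d0" "M * d0 < d + 1" using d0 by (simp_all add: d_def) linarith
  have "real d < CARD('a) * w"
  proof -
    have "real d \<le> CARD('a) * (M * t)" using d(1) unfolding t(2)[symmetric] by (simp add: mult_ac)
    also have "\<dots> < CARD('a) * real w" using w(1) by (intro mult_strict_left_mono) simp_all
    finally show ?thesis by simp
  qed
  then have dw: "d < CARD('a) * w" by (metis of_nat_less_iff of_nat_mult)
  have termwise: "real (fact N * ((g x + N - 1) choose N)) \<le> real M ^ N * (real (f x) + t + real N / real M) ^ N"
    if "x \<in> T" for x
  proof -
    have "real (fact N * ((g x + N - 1) choose N)) \<le> real ((g x + N - 1) ^ N)"
      using binomial_fact_pow[of "g x + N - 1" N] by (simp only: of_nat_le_iff mult.commute)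
    also have "\<dots> = real (g x + N - 1) ^ N" by simp
    also have "\<dots> \<le> (M * f x + M * t + N) ^ N"
    proof (rule power_mono)
      have "g x + N - 1 = M * f x + w + (N - 1)" using that N by (simp add: g_def)
      then have "real (g x + N - 1) = real M * f x + w + (real N - 1)" using N by (simp add: of_nat_diff)
      then show "real (g x + N - 1) \<le> M * f x + M * t + N" using w(2) by simp
    qed simp
    also have "\<dots> = (M * (real (f x) + t + real N / real M)) ^ N"
      using M(1) by (simp add: distrib_left)
    finally show ?thesis by (simp only: power_mult_distrib)
  qed
  have "real (fact N * (\<Sum>x\<in>fin_points I. (g x + N - 1) choose N)) =
      real (\<Sum>x\<in>T. fact N * ((g x + N - 1) choose N))"
  proof -
    have "(\<Sum>x\<in>fin_points I. (g x + N - 1) choose N) = (\<Sum>x\<in>T. (g x + N - 1) choose N)"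
      by (rule sum.mono_neutral_right) (use T I N finite_fin_points[OF I(1)] in \<open>auto simp: g_def\<close>)
    then show ?thesis by (simp add: sum_distrib_left)
  qed
  also have "\<dots> \<le> real M ^ N * (\<Sum>x\<in>T. (real (f x) + t + real N / real M) ^ N)"
    unfolding of_nat_sum sum_distrib_left by (rule sum_mono) (rule termwise)
  also have "\<dots> < real M ^ N * d0 ^ N" using M by (intro mult_strict_left_mono) auto
  also have "\<dots> = (M * d0) ^ N" by (simp add: power_mult_distrib)
  also have "\<dots> \<le> real (d + 1) ^ N" using d(2) d0 by (intro power_mono) auto
  also have "\<dots> \<le> real (fact N * ((d + N) choose N))"
    using fact_mult_choose_ge_power[of d N] by (metis of_nat_le_iff of_nat_power)
  finally have "fact N * (\<Sum>x\<in>fin_points I. (g x + N - 1) choose N) < fact N * ((d + N) choose N)"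
    by (simp only: of_nat_less_iff)
  then have "(\<Sum>x\<in>fin_points I. (g x + N - 1) choose N) < (d + N) choose N" by simp
  from exists_direction_small_multiplicity[OF I dw this[unfolded N_def]]
  obtain b where b: "b \<in> fin_points I" "b \<noteq> (\<lambda>_. 0)"
    "\<And>a. a \<in> fin_points I \<Longrightarrow> (\<Sum>s\<in>UNIV. g (\<lambda>i. a i + s * b i) - w) \<le> d" by blast
  have "(\<Sum>s\<in>UNIV. if (\<lambda>i. a i + s * b i) \<in> T then real (f (\<lambda>i. a i + s * b i)) else 0) \<le> d0"
    if "a \<in> fin_points I" for a
  proof -
    have "M * (\<Sum>s\<in>UNIV. if (\<lambda>i. a i + s * b i) \<in> T then real (f (\<lambda>i. a i + s * b i)) else 0) =
        real (\<Sum>s\<in>UNIV. g (\<lambda>i. a i + s * b i) - w)"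
      unfolding sum_distrib_left of_nat_sum by (intro sum.cong) (auto simp: g_def)
    also have "\<dots> \<le> M * d0" using b(3)[OF that] d(1) by linarith
    finally show ?thesis using M(1) by simp
  qed
  then show ?thesis using b(1,2) by blast
qed

section \<open>Enlarging a subspace one direction at a time\<close>

text \<open>One factor \<open>u\<close> is kept so that summing over translates produces
  \<open>card S\<close>. If \<open>t \<le> u\<close>, one factor is at most \<open>2 * u\<close> and
  the others cost \<open>exp (1 / 40) \<le> 3 / 2\<close> altogether. If \<open>u < t\<close>, two
  factors \<open>2 * t\<close> are available since \<open>2 \<le> N\<close>; one \<open>t\<close> is
  traded for \<open>n * u\<close>, and \<open>4 * n * t\<close> stays below \<open>3 * L\<close>.
  The constant 3 must beat the 4 in \<open>\<beta> ^ n = 4 * card S\<close>.\<close>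

lemma add_power_le_of_small_shift:
  fixes u t L :: real
  assumes N: "2 \<le> N" "N \<le> n" and t: "0 < t" "40 * real n ^ 2 * t \<le> L" and u: "t / n \<le> u" "u \<le> L"
  shows "(u + t) ^ N \<le> 3 * u * L ^ (N - 1)"
proof -
  have n: "real n \<ge> 2" using N by linarith
  have u0: "u > 0" using t(1) n u(1) divide_pos_pos[of t "real n"] by linarith
  obtain N' where N': "N = Suc N'" "N' \<ge> 1" using N(1) by (cases N) auto
  have L0: "L > 0" using u0 u(2) by linarith
  have nn: "real n \<le> real n ^ 2" using n by (simp add: power2_eq_square)
  then have tL: "40 * real n * t \<le> L" using t mult_right_mono[of "40 * real n" "40 * real n ^ 2" t] by linarith
  show ?thesis
  proof (cases "t \<le> u")
    case True
    have "(1 + t / L) ^ N' \<le> exp (t / L) ^ N'" using t(1) L0 by (intro power_mono exp_ge_add_one_self) auto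
    also have "\<dots> = exp (N' * (t / L))" by (rule exp_of_nat_mult[symmetric])
    also have "\<dots> \<le> exp (1 / 40)"
    proof -
      have "N' * t \<le> n * t" using N N' t(1) by (intro mult_right_mono) auto
      then have "N' * (t / L) \<le> 1 / 40" using tL L0 by (simp add: field_simps)
      then show ?thesis by simp
    qed
    also have "\<dots> \<le> 3 / 2"
      using exp_bound[of "1/40"] by (simp add: power2_eq_square)
    finally have e: "(1 + t / L) ^ N' \<le> 3 / 2" .
    have "(u + t) ^ N = (u + t) * (u + t) ^ N'" by (simp add: N')
    also have "\<dots> \<le> (2 * u) * (L + t) ^ N'" using True u0 t(1) u(2) by (intro mult_mono power_mono) auto
    also have "(L + t) ^ N' = L ^ N' * (1 + t / L) ^ N'"
      using L0 by (simp add: power_mult_distrib[symmetric] distrib_left)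
    also have "2 * u * (L ^ N' * (1 + t / L) ^ N') \<le> 2 * u * (L ^ N' * (3 / 2))"
      using e u0 L0 by (intro mult_left_mono) auto
    finally show ?thesis by (simp add: N')
  next
    case False
    have t1: "2 * t \<le> L" using tL n t(1) mult_right_mono[of 2 "40 * real n" t] by linarith
    obtain N'' where N'': "N' = Suc N''" using N'(2) by (cases N') auto
    have "(u + t) ^ N \<le> (2 * t) ^ N" using False u0 by (intro power_mono) auto
    also have "\<dots> = 4 * t * t * (2 * t) ^ N''" by (simp add: N' N'')
    also have "\<dots> \<le> 4 * t * t * L ^ N''" using t1 t(1) by (intro mult_left_mono power_mono) auto
    also have "\<dots> \<le> 4 * t * (u * n) * L ^ N''"
      using u(1) n t(1) L0 by (intro mult_right_mono mult_left_mono) (auto simp: field_simps)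
    also have "\<dots> = u * (4 * n * t) * L ^ N''" by simp
    also have "\<dots> \<le> u * (3 * L) * L ^ N''"
    proof -
      have "4 * n * t \<le> 40 * n * t" using t(1) by (intro mult_right_mono) auto
      also have "\<dots> \<le> 3 * L" using tL L0 by linarith
      finally show ?thesis using u0 L0 by (intro mult_right_mono mult_left_mono) auto
    qed
    finally show ?thesis by (simp add: N' N'' mult_ac)
  qed
qed

lemma card_basis_vec:
  fixes X :: "('a::field ^ 'n) set"
  assumes "vec.independent X" "vec.span X = UNIV"
  shows "card X = CARD('n)"
  using vec.dim_span_eq_card_independent[OF assms(1)] assms(2) by (simp add: card_cart_basis)

text \<open>Completing \<open>B\<close> to a basis by \<open>C\<close> gives coordinates on the
  quotient by \<open>vec.span B\<close>: each translate is \<open>\<psi> y\<close> plus the span for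
  exactly one \<open>y\<close>. A translate of the enlarged span is the union of the translates
  along a line of the quotient, so it suffices to bound line sums of \<open>f\<close>. The condition
  \<open>j + 2 \<le> n\<close> makes the quotient at least two-dimensional.\<close>

lemma extend_flat_direction:
  fixes S :: "('a::{field,finite} ^ 'n) set" and \<beta> \<rho> :: real
  defines "n \<equiv> CARD('n)"
  assumes B: "vec.independent B" "card B = j" and j: "j + 2 \<le> n"
    and bnd: "\<And>a. real (card (S \<inter> {v + a | v. v \<in> vec.span B})) \<le> \<rho> ^ j"
    and \<beta>: "\<beta> > 0" "\<beta> ^ n = 4 * card S" and \<rho>: "\<rho> = (1 + 1 / n) * \<beta>"
    and q: "40 * real n ^ 2 * \<beta> \<le> CARD('a)"
  shows "\<exists>B'. vec.independent B' \<and> card B' = Suc j \<and>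
    (\<forall>a. real (card (S \<inter> {v + a | v. v \<in> vec.span B'})) \<le> \<rho> ^ Suc j)"
proof -
  let ?X = "vec.extend_basis B"
  define C where "C = ?X - B"
  have X: "vec.independent ?X" "B \<subseteq> ?X" "vec.span ?X = UNIV"
    using vec.independent_extend_basis[OF B(1)] vec.extend_basis_superset[OF B(1)]
      vec.span_extend_basis[OF B(1)] by auto
  have XBC: "?X = B \<union> C" "B \<inter> C = {}" using X(2) by (auto simp: C_def)
  have "card ?X = n"
    using card_basis_vec[OF X(1,3)] by (simp add: n_def)
  then have cC: "card C = n - j"
    using B(2) X(2) by (simp add: C_def card_Diff_subset)
  define N where "N = n - j"
  have N: "2 \<le> N" "N \<le> n" using j by (auto simp: N_def)
  have C: "finite C" "C \<noteq> {}" using cC N by (auto simp: N_def)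
  define \<psi> where "\<psi> = (\<lambda>y :: 'a ^ 'n \<Rightarrow> 'a. \<Sum>v\<in>C. y v *s v)"
  have \<psi>_add: "\<psi> (\<lambda>v. y v + s * b v) = \<psi> y + s *s \<psi> b" for y b s
    by (simp add: \<psi>_def vec.scale_left_distrib sum.distrib vec.scale_sum_right)
  have decomp: "\<exists>y\<in>fin_points C. \<exists>w\<in>vec.span B. a = w + \<psi> y" for a
  proof -
    have "a \<in> vec.span (B \<union> C)" using X(3) XBC by simp
    then obtain w z where wz: "w \<in> vec.span B" "z \<in> vec.span C" "a = w + z"
      by (auto simp: vec.span_Un)
    then obtain u where u: "z = (\<Sum>v\<in>C. u v *s v)" using vec.span_finite[OF C(1)] by auto
    have "z = \<psi> (\<lambda>v. if v \<in> C then u v else 0)" unfolding u \<psi>_def by (rule sum.cong) auto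
    then show ?thesis using wz by (intro bexI[of _ "\<lambda>v. if v \<in> C then u v else 0"]) (auto simp: fin_points_def)
  qed
  have inj: "y = (\<lambda>_. 0)" if y: "y \<in> fin_points C" "\<psi> y \<in> vec.span B" for y
  proof -
    obtain r where r: "\<psi> y = (\<Sum>v\<in>B. r v *s v)" using y(2) vec.span_finite[of B] by auto
    define u where "u = (\<lambda>v. if v \<in> C then y v else - r v)"
    have "(\<Sum>v\<in>?X. u v *s v) = (\<Sum>v\<in>B. u v *s v) + (\<Sum>v\<in>C. u v *s v)"
      unfolding XBC(1) by (rule sum.union_disjoint) (use XBC in auto)
    also have "(\<Sum>v\<in>B. u v *s v) = (\<Sum>v\<in>B. - (r v *s v))"
      by (rule sum.cong) (use XBC(2) in \<open>auto simp: u_def\<close>)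
    also have "(\<Sum>v\<in>C. u v *s v) = \<psi> y" unfolding \<psi>_def by (rule sum.cong) (auto simp: u_def)
    finally have "(\<Sum>v\<in>?X. u v *s v) = 0" using r by (simp add: sum_negf)
    then have "\<forall>v\<in>?X. u v = 0" using X(1) vec.dependent_finite[of ?X] by auto
    then have "u v = 0" if "v \<in> C" for v using that unfolding XBC(1) by blast
    then have "y v = 0" if "v \<in> C" for v using that by (metis u_def)
    then have "y v = 0" for v using y(1) by (cases "v \<in> C") (auto simp: fin_points_def)
    then show ?thesis by auto
  qed
  define F where "F = (\<lambda>y. S \<inter> {w + \<psi> y | w. w \<in> vec.span B})"
  define f where "f = (\<lambda>y. card (F y))"
  have f_le: "real (f y) \<le> \<rho> ^ j" for y using bnd by (simp add: f_def F_def)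
  have "(\<Sum>y\<in>fin_points C. f y) = card (\<Union>y\<in>fin_points C. F y)"
    unfolding f_def
  proof (rule card_UN_disjoint[symmetric])
    show "finite (fin_points C :: ('a ^ 'n \<Rightarrow> 'a) set)" by (rule finite_fin_points[OF C(1)])
    show "\<forall>y\<in>fin_points C. finite (F y)" by simp
    show "\<forall>y\<in>fin_points C. \<forall>y'\<in>fin_points C. y \<noteq> y' \<longrightarrow> F y \<inter> F y' = {}"
    proof (intro ballI impI, rule ccontr)
      fix y y' :: "'a ^ 'n \<Rightarrow> 'a" assume y: "y \<in> fin_points C" "y' \<in> fin_points C" "y \<noteq> y'" "F y \<inter> F y' \<noteq> {}"
      then obtain w w' where w: "w \<in> vec.span B" "w' \<in> vec.span B" "w + \<psi> y = w' + \<psi> y'"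
        by (auto simp: F_def)
      \<comment> \<open>The difference is written with parameter -1 to fit
        \<open>\<psi>_add\<close>.\<close>
      have "\<psi> (\<lambda>v. y v + (-1) * y' v) = w' - w" unfolding \<psi>_add using w(3) by (simp add: algebra_simps)
      then have "\<psi> (\<lambda>v. y v + (-1) * y' v) \<in> vec.span B" using w by (simp add: vec.span_diff)
      then have "(\<lambda>v. y v + (-1) * y' v) = (\<lambda>_. 0)" using y by (intro inj) (auto simp: fin_points_def)
      then show False using y(3) by (auto simp: fun_eq_iff)
    qed
  qed
  also have "\<dots> \<le> card S" by (rule card_mono) (auto simp: F_def)
  finally have f_sum: "(\<Sum>y\<in>fin_points C. f y) \<le> card S" .
  \<comment> \<open>Chosen so that \<open>d0 + d0 / n = \<rho> ^ Suc j\<close>; the summand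
    \<open>d0 / n\<close> is the allowance for translates outside \<open>T\<close>.\<close>
  define d0 where "d0 = \<beta> * \<rho> ^ j"
  define t where "t = d0 / CARD('a)"
  have n0: "real n > 0" using j by simp
  have \<rho>\<beta>: "\<beta> \<le> \<rho>" "\<rho> > 0" using \<beta>(1) n0 unfolding \<rho> by (auto simp: field_simps intro: add_pos_pos)
  have L0: "\<rho> ^ j > 0" using \<rho>\<beta> by simp
  have q0: "real CARD('a) > 0" by simp
  have d0: "d0 > 0" using \<beta>(1) L0 by (simp add: d0_def)
  have t0: "t > 0" "CARD('a) * t = d0" using d0 by (auto simp: t_def)
  have tL: "40 * real n ^ 2 * t \<le> \<rho> ^ j"
  proof -
    have "40 * real n ^ 2 * t = (40 * real n ^ 2 * \<beta>) / CARD('a) * \<rho> ^ j" by (simp add: t_def d0_def)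
    also have "\<dots> \<le> 1 * \<rho> ^ j" using q L0 q0 by (intro mult_right_mono) auto
    finally show ?thesis by simp
  qed
  \<comment> \<open>The values below \<open>t / n\<close> contribute at most \<open>d0 / n\<close> to a line, and on the others
    \<open>f + t\<close> is comparable to \<open>f\<close> in the sum of \<open>N\<close>-th powers.\<close>
  define T where "T = {y \<in> fin_points C. t / n \<le> f y}"
  have TC: "T \<subseteq> fin_points C" by (auto simp: T_def)
  have "(\<Sum>y\<in>T. (real (f y) + d0 / CARD('a)) ^ card C) \<le> (\<Sum>y\<in>T. 3 * real (f y) * (\<rho> ^ j) ^ (N - 1))"
    unfolding cC N_def[symmetric] t_def[symmetric]
    by (intro sum_mono add_power_le_of_small_shift[OF N t0(1) tL]) (use f_le in \<open>auto simp: T_def\<close>)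
  also have "\<dots> = 3 * (\<rho> ^ j) ^ (N - 1) * (\<Sum>y\<in>T. real (f y))"
    unfolding sum_distrib_left by (intro sum.cong) (simp_all add: mult_ac)
  also have "\<dots> \<le> 3 * (\<rho> ^ j) ^ (N - 1) * real (card S)"
  proof -
    have "(\<Sum>y\<in>T. f y) \<le> (\<Sum>y\<in>fin_points C. f y)"
      by (intro sum_mono2 finite_fin_points C TC) auto
    then have "(\<Sum>y\<in>T. real (f y)) \<le> real (card S)" using f_sum unfolding of_nat_sum[symmetric] by linarith
    then show ?thesis using L0 by (intro mult_left_mono) auto
  qed
  also have "\<dots> = 3 / 4 * (\<beta> ^ n * (\<rho> ^ j) ^ (N - 1))" using \<beta>(2) by simp
  also have "\<dots> < \<beta> ^ n * (\<rho> ^ j) ^ (N - 1)" using \<beta>(1) L0 by simp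
  \<comment> \<open>Since \<open>n = N + j\<close>, replacing the factor \<open>\<beta> ^ j\<close>
    by \<open>\<rho> ^ j\<close> completes the \<open>N\<close>-th power of
    \<open>d0\<close>.\<close>
  also have "\<dots> = \<beta> ^ N * (\<beta> ^ j * (\<rho> ^ j) ^ (N - 1))" using j by (simp add: N_def flip: power_add)
  also have "\<dots> \<le> \<beta> ^ N * (\<rho> ^ j * (\<rho> ^ j) ^ (N - 1))"
    using \<rho>\<beta> \<beta>(1) L0 by (intro mult_left_mono mult_right_mono power_mono) auto
  also have "\<dots> = d0 ^ card C"
    using N(1) unfolding cC N_def[symmetric] d0_def power_mult_distrib by (cases N) auto
  finally have less: "(\<Sum>y\<in>T. (real (f y) + d0 / CARD('a)) ^ card C) < d0 ^ card C" .
  obtain b where b: "b \<in> fin_points C" "b \<noteq> (\<lambda>_. 0)"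
    "\<And>a. a \<in> fin_points C \<Longrightarrow>
      (\<Sum>s\<in>UNIV. if (\<lambda>i. a i + s * b i) \<in> T then real (f (\<lambda>i. a i + s * b i)) else 0) \<le> d0"
    using exists_direction_small_sum[OF C d0 TC less] by blast
  have line: "(\<Sum>s\<in>UNIV. real (f (\<lambda>i. a i + s * b i))) \<le> \<rho> ^ Suc j" if a: "a \<in> fin_points C" for a
  proof -
    have "(\<Sum>s\<in>UNIV. real (f (\<lambda>i. a i + s * b i))) \<le>
        (\<Sum>s\<in>UNIV. (if (\<lambda>i. a i + s * b i) \<in> T then real (f (\<lambda>i. a i + s * b i)) else 0) + t / n)"
    proof (rule sum_mono)
      fix s
      have "(\<lambda>i. a i + s * b i) \<in> fin_points C" using a b(1) by (auto simp: fin_points_def)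
      then show "real (f (\<lambda>i. a i + s * b i)) \<le>
          (if (\<lambda>i. a i + s * b i) \<in> T then real (f (\<lambda>i. a i + s * b i)) else 0) + t / n"
        using t0(1) by (auto simp: T_def)
    qed
    also have "\<dots> \<le> d0 + CARD('a) * (t / n)" using b(3)[OF a] by (simp add: sum.distrib)
    also have "\<dots> = d0 + d0 / n" using t0(2) by (metis times_divide_eq_right)
    also have "\<dots> = \<rho> ^ Suc j" by (simp add: d0_def \<rho> algebra_simps)
    finally show ?thesis .
  qed
  define B' where "B' = insert (\<psi> b) B"
  have nin: "\<psi> b \<notin> vec.span B" using inj[OF b(1)] b(2) by blast
  have "vec.independent B'" unfolding B'_def using nin B(1) by (simp add: vec.independent_insert)
  moreover have "card B' = Suc j"
    using nin B(2) vec.span_base[of "\<psi> b" B] unfolding B'_def by (subst card_insert_disjoint) auto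
  moreover have "real (card (S \<inter> {v + a | v. v \<in> vec.span B'})) \<le> \<rho> ^ Suc j" for a
  proof -
    obtain y w where yw: "y \<in> fin_points C" "w \<in> vec.span B" "a = w + \<psi> y" using decomp[of a] by blast
    have "S \<inter> {v + a | v. v \<in> vec.span B'} \<subseteq> (\<Union>s\<in>UNIV. F (\<lambda>i. y i + s * b i))"
    proof
      fix x assume "x \<in> S \<inter> {v + a | v. v \<in> vec.span B'}"
      then obtain v where v: "x \<in> S" "x = v + a" "v \<in> vec.span B'" by auto
      then obtain s where s: "v - s *s \<psi> b \<in> vec.span B" by (auto simp: B'_def vec.span_insert)
      have "x = (v - s *s \<psi> b + w) + \<psi> (\<lambda>i. y i + s * b i)"
        unfolding \<psi>_add v(2) yw(3) by (simp add: algebra_simps)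
      moreover have "v - s *s \<psi> b + w \<in> vec.span B" using s yw(2) by (rule vec.span_add)
      ultimately have "x \<in> F (\<lambda>i. y i + s * b i)" using v(1) unfolding F_def by blast
      then show "x \<in> (\<Union>s\<in>UNIV. F (\<lambda>i. y i + s * b i))" by blast
    qed
    then have "card (S \<inter> {v + a | v. v \<in> vec.span B'}) \<le> card (\<Union>s\<in>UNIV. F (\<lambda>i. y i + s * b i))"
      by (intro card_mono) auto
    also have "\<dots> \<le> (\<Sum>s\<in>UNIV. f (\<lambda>i. y i + s * b i))" unfolding f_def by (rule card_UN_le) simp
    finally have "real (card (S \<inter> {v + a | v. v \<in> vec.span B'})) \<le> (\<Sum>s\<in>UNIV. real (f (\<lambda>i. y i + s * b i)))"
      unfolding of_nat_sum[symmetric] by (rule of_nat_mono)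
    then show ?thesis using line[OF yw(1)] by linarith
  qed
  ultimately show ?thesis by blast
qed

text \<open>Start from the zero subspace, whose translates are single points. The hypothesis
  \<open>k < n\<close> ensures that the quotient still has dimension at least two at every
  extension.\<close>

lemma exists_direction_small_flats:
  fixes S :: "('a::{field,finite} ^ 'n) set" and \<beta> \<rho> :: real
  defines "n \<equiv> CARD('n)"
  assumes k: "k < n"
    and \<beta>: "\<beta> > 0" "\<beta> ^ n = 4 * card S" and \<rho>: "\<rho> = (1 + 1 / n) * \<beta>"
    and q: "40 * real n ^ 2 * \<beta> \<le> CARD('a)"
  shows "\<exists>B. vec.independent B \<and> card B = k \<and>
    (\<forall>a. real (card (S \<inter> {v + a | v. v \<in> vec.span B})) \<le> \<rho> ^ k)"
  using k
proof (induction k)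
  case 0
  have "card (S \<inter> {v + a | v. v \<in> vec.span {}}) \<le> 1" for a
    using card_mono[of "{a}" "S \<inter> {v + a | v. v \<in> vec.span {}}"] by auto
  then show ?case by (intro exI[of _ "{}"]) (auto simp: vec.independent_empty)
next
  case (Suc j)
  then obtain B where "vec.independent B" "card B = j"
    "\<And>a. real (card (S \<inter> {v + a | v. v \<in> vec.span B})) \<le> \<rho> ^ j" by auto
  then show ?case
    using Suc.prems \<beta> \<rho> q unfolding n_def by (intro extend_flat_direction[of B j S \<rho> \<beta>]) auto
qed

section \<open>From sparse flats to the Furstenberg bound\<close>

theorem theorem1p4:
  fixes S :: "('a::{field,finite} ^ 'n) set"
    and q n k :: nat and \<epsilon> m :: real
  assumes "q = CARD('a)" and "n = CARD('n)"
    and "1 \<le> k" and "k \<le> n"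
    and "0 < \<epsilon>" and "\<epsilon> \<le> 1/2"
    and "m = real q powr ((1 - \<epsilon>) * real k)"
    and "real q \<ge> (2 * exp 1 ^ 3 * (real n)\<^sup>2) powr (1 / \<epsilon>)"
    and "furstenberg k m S"
  shows "real (card S) \<ge> 1 / (2 * exp 1) ^ (n - k + 1) * m powr (real n / real k)"
proof -
  have q0: "real q > 0" by (simp add: assms(1))
  have n0: "real n > 0" "real k > 0" using assms by auto
  have m0: "m > 0" using q0 by (simp add: assms(7))
  have flat: "\<exists>a. m \<le> real (card (S \<inter> {v + a | v. v \<in> vec.span B}))"
    if "vec.independent B" "card B = k" for B
    using assms(9) that vec.dim_span_eq_card_independent[OF that(1)]
    unfolding furstenberg_def by (simp add: vec.subspace_span)
  have e2: "exp 1 \<ge> (2::real)" using exp_ge_add_one_self[of 1] by simp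
  have mk: "m powr (real n / real k) = real q powr ((1 - \<epsilon>) * n)"
    using n0 by (simp add: assms(7) powr_powr)
  show ?thesis
  proof (cases "k = n")
    \<comment> \<open>Here the subspace is the whole space, so \<open>m \<le> card S\<close>, and
      the exponent \<open>n / k\<close> is 1.\<close>
    case True
    obtain X :: "('a ^ 'n) set" where X: "vec.independent X" "vec.span X = UNIV"
      using vec.independent_extend_basis[OF vec.independent_empty] vec.span_extend_basis[OF vec.independent_empty] by blast
    have "card X = k"
      using card_basis_vec[OF X] True assms(2) by simp
    then obtain a where "m \<le> real (card (S \<inter> {v + a | v. v \<in> vec.span X}))" using flat X(1) by blast
    also have "\<dots> \<le> real (card S)" by (intro of_nat_mono card_mono) auto
    finally have mS: "m \<le> real (card S)" .
    have "1 / (2 * exp 1) ^ (n - k + 1) * m powr (real n / real k) = m / (2 * exp 1)"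
      using True n0 m0 by simp
    also have "\<dots> \<le> m / 1" using e2 m0 by (intro divide_left_mono) auto
    finally show ?thesis using mS by simp
  next
    case False
    then have kn: "k < n" using assms by simp
    \<comment> \<open>As \<open>k < n\<close>, the exponent \<open>n - k + 1\<close> is at least 2,
      so it suffices to lose \<open>(2 * exp 1) ^ 2\<close>.\<close>
    have two: "(2 * exp 1) ^ 2 \<le> (2 * exp (1::real)) ^ (n - k + 1)"
      using kn e2 by (intro power_increasing) auto
    have main: "m powr (real n / real k) \<le> (2 * exp 1) ^ 2 * real (card S)"
    proof (cases "m powr (real n / real k) \<le> 4 * real (card S)")
      case True
      also have "4 * real (card S) \<le> (2 * exp 1) ^ 2 * real (card S)"
        using power_mono[of 2 "2 * exp (1::real)" 2] e2 by (intro mult_right_mono) auto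
      finally show ?thesis .
    next
      case far: False
      \<comment> \<open>Any \<open>k\<close>-dimensional subspace will do: a translate of it meets
        \<open>S\<close>, hence \<beta> is positive.\<close>
      obtain X :: "('a ^ 'n) set" where "X \<subseteq> vec.extend_basis {}" "card X = k"
      proof -
        have "card (vec.extend_basis {} :: ('a ^ 'n) set) = n"
          unfolding assms(2)
          by (intro card_basis_vec vec.independent_extend_basis vec.span_extend_basis vec.independent_empty)
        then show ?thesis using obtain_subset_with_card_n[of k "vec.extend_basis {} :: ('a ^ 'n) set"] kn that by auto
      qed
      then have "\<exists>a. m \<le> real (card (S \<inter> {v + a | v. v \<in> vec.span X}))"
        using flat vec.independent_mono[OF vec.independent_extend_basis[OF vec.independent_empty]] by blast
      then have S0: "card S > 0" using m0 by (auto simp: card_gt_0_iff)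
      define \<beta> where "\<beta> = root n (4 * card S)"
      define \<rho> where "\<rho> = (1 + 1 / n) * \<beta>"
      have \<beta>: "\<beta> > 0" "\<beta> ^ n = 4 * card S" using S0 n0 by (auto simp: \<beta>_def)
      have "\<beta> ^ n < (real q powr (1 - \<epsilon>)) ^ n"
        using far \<beta>(2) q0 n0 by (simp add: mk powr_powr flip: powr_realpow)
      then have "\<beta> \<le> real q powr (1 - \<epsilon>)" by (meson power_less_imp_less_base powr_ge_zero less_imp_le)
      have qe: "2 * exp 1 ^ 3 * (real n)\<^sup>2 \<le> real q powr \<epsilon>"
      proof -
        have "2 * exp 1 ^ 3 * (real n)\<^sup>2 = ((2 * exp 1 ^ 3 * (real n)\<^sup>2) powr (1 / \<epsilon>)) powr \<epsilon>"
          using assms(5) n0 by (simp add: powr_powr)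
        also have "\<dots> \<le> real q powr \<epsilon>" using assms(5,8) by (intro powr_mono2) auto
        finally show ?thesis .
      qed
      \<comment> \<open>This converts the lower bound on \<open>q\<close> into the constant 40 of
        the smallness condition on \<open>\<beta> / q\<close>.\<close>
      have "(20::real) \<le> exp 1 ^ 3"
      proof -
        have "(20::real) \<le> (2.7182 :: real) ^ 3" by (simp add: power3_eq_cube)
        also have "\<dots> \<le> exp 1 ^ 3" using e_approx_32 by (intro power_mono) (auto simp: abs_if split: if_splits)
        finally show ?thesis .
      qed
      then have "40 * real n ^ 2 \<le> 2 * exp 1 ^ 3 * (real n)\<^sup>2" by (intro mult_right_mono) auto
      then have "40 * real n ^ 2 \<le> real q powr \<epsilon>" using qe by linarith
      then have "40 * real n ^ 2 * \<beta> \<le> real q powr \<epsilon> * real q powr (1 - \<epsilon>)"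
        using \<open>\<beta> \<le> _\<close> \<beta>(1) by (intro mult_mono) auto
      also have "\<dots> = real CARD('a)" using q0 by (simp add: assms(1) flip: powr_add)
      finally have q\<beta>: "40 * real n ^ 2 * \<beta> \<le> real CARD('a)" .
      obtain B :: "('a ^ 'n) set" where B: "vec.independent B" "card B = k"
        "\<And>a. real (card (S \<inter> {v + a | v. v \<in> vec.span B})) \<le> \<rho> ^ k"
        using exists_direction_small_flats[of k \<beta> S \<rho>] kn \<beta> \<rho>_def q\<beta> unfolding assms(2) by blast
      have \<rho>0: "\<rho> > 0" using \<beta>(1) n0 by (simp add: \<rho>_def add_pos_pos)
      have "m \<le> \<rho> ^ k" using flat[OF B(1,2)] B(3) order_trans by blast
      then have "m powr (real n / real k) \<le> (\<rho> ^ k) powr (real n / real k)"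
        using m0 n0 by (intro powr_mono2) auto
      also have "\<dots> = \<rho> ^ n" using \<rho>0 n0 by (simp add: powr_powr flip: powr_realpow)
      also have "\<dots> = (1 + 1 / n) ^ n * (4 * card S)" by (simp add: \<rho>_def power_mult_distrib \<beta>(2))
      also have "\<dots> \<le> exp 1 * (4 * card S)"
        using exp_ge_one_plus_x_over_n_power_n[of n 1] n0 by (intro mult_right_mono) auto
      also have "\<dots> \<le> (2 * exp 1) ^ 2 * real (card S)" using e2 mult_right_mono[of 1 "exp 1" "real (card S)"] by (simp add: power2_eq_square)
      finally show ?thesis .
    qed
    have "m powr (real n / real k) \<le> (2 * exp 1) ^ (n - k + 1) * real (card S)"
      using main two by (meson mult_right_mono of_nat_0_le_iff order_trans)
    then show ?thesis by (simp add: field_simps)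
  qed
qed

end
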